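(* Let $n$ be an integer. If $S\subset\mathbb{F}_2^n$ is $(3,2)$-orthogonal with respect to the dot product $\bm{x}\cdot\bm{y}=\sum_i x_iy_i$, then \[ |S| \leq \begin{cases} 2^{\frac{n+1}{2}}+1, &\text{if } n\geq 21 \text{ is odd};\\ 2^{\frac{n}{2}+1}-3, &\text{if } n\geq 18 \text{ is even}.\end{cases} \] Moreover, for even $n\geq 2$, if $S\subset\mathbb{F}_2^n$ is $(3,2)$-orthogonal with respect to the hyperbolic form $\mathcal{H}$, then $|S|\leq 2^{\frac{n}{2}+1}-2$.
   Context: For even $n$, the hyperbolic form $\mathcal{H}$ on $\mathbb{F}_2^n$ is the bilinear form $\mathcal{H}(\bm{x},\bm{y})=\bm{x}^T M\bm{y}$ where $M=H\oplus\cdots\oplus H$ is block diagonal with $n/2$ copies of $H=\begin{pmatrix}0&1\\1&0\end{pmatrix}$. Given a bilinear form $\mathcal{B}$, two nonzero vectors $\bm{v}_1,\bm{v}_2$ are mutually orthogonal if $\mathcal{B}(\bm{v}_1,\bm{v}_2)=0$. A set $S\subset\mathbb{F}_2^n\setminus\{\bm{0}\}$ is $(3,2)$-orthogonal (with respect to $\mathcal{B}$) if among any three distinct elements of $S$ at least two are mutually orthogonal. *)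

theory Defs
  imports "Jordan_Normal_Form.Matrix" "HOL-Library.Z2"
begin

(* The field with two elements is the type bit of HOL-Library.Z2; the space of
   vectors of length n over it is "carrier_vec n :: bit vec set". *)

definition hyperbolic_block :: "bit mat" where
  "hyperbolic_block = mat_of_rows_list 2 [[0, 1], [1, 0]]"

(* For even n this is an n x n matrix; for odd n it has size n - 1, so it is only
   meaningful for even n. *)
definition hyperbolic_mat :: "nat \<Rightarrow> bit mat" where
  "hyperbolic_mat n = diag_block_mat (replicate (n div 2) hyperbolic_block)"

definition hyperbolic_form :: "nat \<Rightarrow> bit vec \<Rightarrow> bit vec \<Rightarrow> bit" where
  "hyperbolic_form n x y = x \<bullet> (hyperbolic_mat n *\<^sub>v y)"

definition mutually_orthogonal ::
    "nat \<Rightarrow> (bit vec \<Rightarrow> bit vec \<Rightarrow> bit) \<Rightarrow> bit vec \<Rightarrow> bit vec \<Rightarrow> bool" where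
  "mutually_orthogonal n B v w \<longleftrightarrow>
     v \<in> carrier_vec n - {0\<^sub>v n} \<and> w \<in> carrier_vec n - {0\<^sub>v n} \<and> B v w = 0"

(* The two orthogonal elements have to be distinct: self-orthogonality of a single
   element does not count. *)
definition three_two_orthogonal ::
    "nat \<Rightarrow> (bit vec \<Rightarrow> bit vec \<Rightarrow> bit) \<Rightarrow> bit vec set \<Rightarrow> bool" where
  "three_two_orthogonal n B S \<longleftrightarrow>
     S \<subseteq> carrier_vec n - {0\<^sub>v n} \<and>
     (\<forall>x\<in>S. \<forall>y\<in>S. \<forall>z\<in>S. x \<noteq> y \<and> x \<noteq> z \<and> y \<noteq> z \<longrightarrow>
        (\<exists>u\<in>{x, y, z}. \<exists>v\<in>{x, y, z}. u \<noteq> v \<and> mutually_orthogonal n B u v))"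

end

(* Join two vectors by an edge if they are not orthogonal; the hypothesis says that this graph
   on S is triangle-free.  For a nondegenerate alternating form in dimension 2m, an edge xy has
   disjoint neighbourhoods N(x), N(y), each contained in the half of a Lagrangian subspace on which
   x (resp. y) does not vanish, and the other vectors lie in the perp of x and y; induction on m
   gives |S| <= 2^(m+1) - 2, which is the hyperbolic case.

   For the dot product x.x = J.x with J the all-ones vector, so the self-orthogonal vectors of S
   lie in the perp of J, where the form is alternating, and there are at most n(n+3)/2 others, by a
   Ramsey-type recursion in which independent sets are replaced by orthonormal ones.
   If n is even, J spans the radical of its perp, and one non-self-orthogonal vector of S already
   forces a loss exponential in n.
   If n is odd, the perp of J is nondegenerate.  A triangle-free set there with more than 7/8 of
   2^(m+1) elements is contained in two Lagrangians: otherwise it contains a pentagon, or all its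
   degrees are at most 2^(m-2), and both are too expensive.  Relative to two Lagrangians, four
   non-self-orthogonal vectors again force an exponential loss, so there are at most three. *)
theory Submission
  imports Defs "HOL-Library.Function_Algebras"
begin

section \<open>Symplectic spaces over the field with two elements\<close>

locale char_2_form =
  fixes form :: "'a::ab_group_add \<Rightarrow> 'a \<Rightarrow> bit"
  assumes add_self: "x + x = (0::'a)"
    and form_add: "form (x + y) z = form x z + form y z"
    and form_sym: "form x y = form y x"
begin

lemma form_add_right: "form z (x + y) = form z x + form z y"
  by (metis form_add form_sym)

lemma form_zero [simp]: "form 0 x = 0" "form x 0 = 0"
proof -
  show "form 0 x = 0" using form_add[of 0 0 x] by (cases "form 0 x") auto
  then show "form x 0 = 0" by (simp add: form_sym)
qed

lemma add_add_self: "x + y + y = (x::'a)"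
  by (simp add: add.assoc add_self)

definition subspace :: "'a set \<Rightarrow> bool" where
  "subspace V \<longleftrightarrow> finite V \<and> 0 \<in> V \<and> (\<forall>x\<in>V. \<forall>y\<in>V. x + y \<in> V)"

lemma subspaceD:
  assumes "subspace V"
  shows "finite V" "0 \<in> V" "x \<in> V \<Longrightarrow> y \<in> V \<Longrightarrow> x + y \<in> V"
  using assms by (auto simp: subspace_def)

lemma subspace_perp: "subspace V \<Longrightarrow> subspace {u \<in> V. form x u = 0}"
  by (auto simp: subspace_def form_add_right)

lemma subspace_perp2: "subspace V \<Longrightarrow> subspace {u \<in> V. form x u = 0 \<and> form y u = 0}"
  by (auto simp: subspace_def form_add_right)

lemma card_split:
  assumes "finite A"
  shows "card A = card {u \<in> A. form x u = 0} + card {u \<in> A. form x u = 1}"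
proof -
  have "A = {u \<in> A. form x u = 0} \<union> {u \<in> A. form x u = 1}" by auto
  then show ?thesis
    using assms by (subst (1) \<open>A = _\<close>, subst card_Un_disjoint) auto
qed

text \<open>Translation by \<open>v\<close> swaps the two level sets of \<open>form x\<close> on
  \<open>V\<close>.\<close>

lemma card_half:
  assumes V: "subspace V" and v: "v \<in> V" "form x v = 1"
  shows "2 * card {u \<in> V. form x u = c} = card V"
proof -
  have "bij_betw (\<lambda>u. u + v) {u \<in> V. form x u = 0} {u \<in> V. form x u = 1}"
    by (rule bij_betw_byWitness[where f' = "\<lambda>u. u + v"])
      (use V v in \<open>auto simp: add_add_self form_add_right subspaceD(3)[OF V]\<close>)
  then have "card {u \<in> V. form x u = 0} = card {u \<in> V. form x u = 1}"
    by (rule bij_betw_same_card)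
  with card_split[of V x] subspaceD(1)[OF V] show ?thesis
    by (cases c) auto
qed

definition isotropic :: "'a set \<Rightarrow> bool" where
  "isotropic S \<longleftrightarrow> (\<forall>x\<in>S. \<forall>y\<in>S. form x y = 0)"

text \<open>The three vectors need not be distinct, so this is the right notion only where
  \<^term>\<open>form x x = 0\<close>; compare \<open>loopless_triangle_free\<close> below.\<close>

definition triangle_free :: "'a set \<Rightarrow> bool" where
  "triangle_free A \<longleftrightarrow>
     (\<forall>x\<in>A. \<forall>y\<in>A. \<forall>z\<in>A. form x y = 1 \<longrightarrow> form y z = 1 \<longrightarrow> form x z = 0)"

lemma triangle_freeD:
  "triangle_free A \<Longrightarrow> x \<in> A \<Longrightarrow> y \<in> A \<Longrightarrow> z \<in> A \<Longrightarrow>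
     form x y = 1 \<Longrightarrow> form y z = 1 \<Longrightarrow> form x z = 0"
  unfolding triangle_free_def by blast

lemma triangle_free_subset: "triangle_free A \<Longrightarrow> B \<subseteq> A \<Longrightarrow> triangle_free B"
  unfolding triangle_free_def by blast

lemma isotropic_neighbours:
  "triangle_free A \<Longrightarrow> x \<in> A \<Longrightarrow> isotropic {a \<in> A. form x a = 1}"
proof -
  assume A: "triangle_free A" "x \<in> A"
  have "form y z = 0" if "y \<in> A" "z \<in> A" "form x y = 1" "form x z = 1" for y z
    using triangle_freeD[OF A(1) that(1) A(2) that(2)] that by (simp add: form_sym)
  then show ?thesis by (simp add: isotropic_def)
qed

section \<open>Nondegenerate alternating spaces and their Lagrangians\<close>

definition symplectic :: "'a set \<Rightarrow> nat \<Rightarrow> bool" where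
  "symplectic V m \<longleftrightarrow> subspace V \<and> card V = 4 ^ m \<and> (\<forall>x\<in>V. form x x = 0) \<and>
     (\<forall>x\<in>V. (\<forall>y\<in>V. form x y = 0) \<longrightarrow> x = 0)"

lemma symplecticD:
  assumes "symplectic V m"
  shows "subspace V" "card V = 4 ^ m" "x \<in> V \<Longrightarrow> form x x = 0"
    "x \<in> V \<Longrightarrow> x \<noteq> 0 \<Longrightarrow> \<exists>y\<in>V. form x y = 1"
  using assms unfolding symplectic_def by (blast, blast, blast, metis bit_not_one_iff)

text \<open>Splits off the hyperbolic plane of \<open>x\<close> and \<open>y\<close>. Two
  independent conditions quarter the space, and projecting along the plane shows that the perp stays
  nondegenerate.\<close>

lemma symplectic_perp_pair:
  assumes V: "symplectic V (Suc m)" and x: "x \<in> V" and y: "y \<in> V" and xy: "form x y = 1"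
  shows "symplectic {z \<in> V. form x z = 0 \<and> form y z = 0} m"
proof -
  let ?V = "{z \<in> V. form x z = 0 \<and> form y z = 0}"
  note sub = symplecticD(1)[OF V] and alt = symplecticD(3)[OF V]
  have "card ?V = card {z \<in> {z \<in> V. form x z = 0}. form y z = 0}"
    by (rule arg_cong[of _ _ card]) auto
  moreover have "2 * card {z \<in> {z \<in> V. form x z = 0}. form y z = 0} = card {z \<in> V. form x z = 0}"
    by (rule card_half[OF subspace_perp[OF sub], of x x y 0]) (use x xy alt form_sym[of y x] in auto)
  moreover have "2 * card {z \<in> V. form x z = 0} = card V"
    using card_half[OF sub y xy] .
  ultimately have card: "card ?V = 4 ^ m"
    using symplecticD(2)[OF V, unfolded power_Suc] by linarith
  have "z = 0" if z: "z \<in> ?V" and orth: "\<And>w. w \<in> ?V \<Longrightarrow> form z w = 0" for z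
  proof (rule ccontr)
    assume "z \<noteq> 0"
    then obtain w where w: "w \<in> V" "form z w = 1"
      using symplecticD(4)[OF V, of z] z by auto
    \<comment> \<open>The projection of \<open>w\<close> along the plane of \<open>x\<close> and
      \<open>y\<close>. Since \<open>z\<close> is orthogonal to both, its value on \<open>w'\<close>
      is that on \<open>w\<close>.\<close>
    define w' where "w' = w + (if form x w = 1 then y else 0) + (if form y w = 1 then x else 0)"
    have yx: "form y x = 1" using xy form_sym by metis
    have "w' \<in> ?V"
      using w x y xy yx alt subspaceD[OF sub] by (auto simp: w'_def form_add_right)
    moreover have "form z w' = 1"
      using z w form_sym[of z x] form_sym[of z y] by (auto simp: w'_def form_add_right)
    ultimately show False using orth[of w'] by simp
  qed
  then show ?thesis
    using card alt subspace_perp2[OF sub] unfolding symplectic_def by blast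
qed

text \<open>Encoded as a set equal to its own perp in \<open>V\<close>. That it is a subspace, and
  has order \<open>2 ^ m\<close> in the symplectic case, is derived from this.\<close>

definition lagrangian :: "'a set \<Rightarrow> 'a set \<Rightarrow> bool" where
  "lagrangian V U \<longleftrightarrow> U \<subseteq> V \<and> (\<forall>v\<in>V. v \<in> U \<longleftrightarrow> (\<forall>u\<in>U. form v u = 0))"

lemma lagrangianD:
  assumes "lagrangian V U"
  shows "u \<in> U \<Longrightarrow> u \<in> V" "u \<in> U \<Longrightarrow> v \<in> U \<Longrightarrow> form u v = 0"
    "v \<in> V \<Longrightarrow> v \<notin> U \<Longrightarrow> \<exists>u\<in>U. form v u = 1"
  using assms unfolding lagrangian_def by (blast, blast, metis bit_not_one_iff)

lemma lagrangian_subspace: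
  assumes "subspace V" "lagrangian V U"
  shows "subspace U"
proof -
  have "finite U" using assms finite_subset by (auto simp: subspace_def lagrangian_def)
  moreover have "x + y \<in> U" if "x \<in> U" "y \<in> U" for x y
  proof -
    have "x + y \<in> V" "\<forall>u\<in>U. form (x + y) u = 0"
      using that subspaceD(3)[OF assms(1)] lagrangianD(1,2)[OF assms(2)] by (simp_all add: form_add)
    then show ?thesis using assms(2) by (auto simp: lagrangian_def)
  qed
  ultimately show ?thesis using assms by (auto simp: subspace_def lagrangian_def)
qed

text \<open>A maximal isotropic superset works: the form is alternating, so any vector orthogonal to
  all of it could be added. This avoids spans.\<close>

lemma isotropic_extends:
  assumes V: "symplectic V m" and S: "S \<subseteq> V" "isotropic S"
  obtains U where "lagrangian V U" "S \<subseteq> U"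
proof -
  let ?C = "{T. S \<subseteq> T \<and> T \<subseteq> V \<and> isotropic T}"
  have fin: "finite V" using symplecticD(1)[OF V] subspaceD by blast
  then have "finite ?C" by simp
  moreover have "S \<in> ?C" using S by auto
  ultimately obtain U where U: "U \<in> ?C" and max: "\<And>T. T \<in> ?C \<Longrightarrow> U \<subseteq> T \<Longrightarrow> T = U"
    using finite_has_maximal[of ?C] by (metis (lifting) empty_iff)
  have "v \<in> U" if "v \<in> V" "\<forall>u\<in>U. form v u = 0" for v
  proof -
    have "insert v U \<in> ?C"
      using U that symplecticD(3)[OF V] by (auto simp: isotropic_def form_sym)
    from max[OF this] show ?thesis by auto
  qed
  then have "lagrangian V U" using U by (auto simp: lagrangian_def isotropic_def)
  with U that show thesis by auto
qed

text \<open>Induction by splitting off a hyperbolic plane through a nonzero \<open>x\<close> of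
  \<open>U\<close>. The part of \<open>U\<close> orthogonal to \<open>y\<close> is half of
  \<open>U\<close> and is Lagrangian in the perp of the plane.\<close>

lemma card_lagrangian:
  assumes "symplectic V m" "lagrangian V U"
  shows "card U = 2 ^ m"
  using assms
proof (induction m arbitrary: V U)
  case 0
  then have "card V = 1" "0 \<in> V" using symplecticD subspaceD by fastforce+
  then have "V = {0}" by (metis card_1_singletonE singletonD)
  then have "U = {0}" using 0 by (auto simp: lagrangian_def)
  then show ?case by simp
next
  case (Suc m)
  note sub = symplecticD(1)[OF Suc.prems(1)]
  note subU = lagrangian_subspace[OF sub Suc.prems(2)]
  \<comment> \<open>If 0 were the only vector of \<open>U\<close>, everything would be orthogonal to
    \<open>U\<close>, so \<open>V\<close> would be trivial.\<close>
  have "\<exists>x\<in>U. x \<noteq> 0"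
  proof (rule ccontr)
    assume "\<not> ?thesis"
    then have "v \<in> U" if "v \<in> V" for v
    proof -
      have "form v u = 0" if "u \<in> U" for u
        using \<open>\<not> _\<close> that by (cases "u = 0") auto
      then show ?thesis using Suc.prems(2) \<open>v \<in> V\<close> by (auto simp: lagrangian_def)
    qed
    then have "V = {0}"
      using \<open>\<not> _\<close> subspaceD(2)[OF sub] by auto
    then show False using symplecticD(2)[OF Suc.prems(1)] by simp
  qed
  then obtain x where x: "x \<in> U" "x \<noteq> 0" by auto
  with Suc.prems have xV: "x \<in> V" by (auto simp: lagrangian_def)
  then obtain y where y: "y \<in> V" "form x y = 1"
    using symplecticD(4)[OF Suc.prems(1) xV x(2)] by auto
  let ?V = "{z \<in> V. form x z = 0 \<and> form y z = 0}"
  let ?U = "{u \<in> U. form y u = 0}"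
  have "v \<in> ?U" if v: "v \<in> ?V" and orth: "\<forall>u\<in>?U. form v u = 0" for v
  proof -
    have "form v u = 0" if u: "u \<in> U" for u
    proof (cases "form y u = 0")
      case False
      \<comment> \<open>Adding \<open>x\<close> moves \<open>u\<close> into the perp of
        \<open>y\<close> without changing its pairing with \<open>v\<close>, because
        \<open>form x v = 0\<close>.\<close>
      then have "u + x \<in> ?U"
        using u x y subspaceD[OF subU] by (auto simp: form_add_right form_sym)
      then have "form v (u + x) = 0" using orth by blast
      then show ?thesis using v form_sym[of v x] by (simp add: form_add_right)
    qed (use u orth in auto)
    then show ?thesis using v Suc.prems(2) by (auto simp: lagrangian_def)
  qed
  moreover have "?U \<subseteq> ?V" "\<forall>v\<in>?U. \<forall>u\<in>?U. form v u = 0"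
    using lagrangianD(1,2)[OF Suc.prems(2)] x(1) by auto
  ultimately have "lagrangian ?V ?U" unfolding lagrangian_def by blast
  with Suc.IH symplectic_perp_pair[OF Suc.prems(1) xV y] have "card ?U = 2 ^ m" by blast
  moreover have "2 * card ?U = card U"
    using card_half[OF subU x(1), of y 0] y by (simp add: form_sym)
  ultimately show ?case by simp
qed

section \<open>Sizes of isotropic and triangle-free sets\<close>

lemma card_isotropic:
  assumes "symplectic V m" "S \<subseteq> V" "isotropic S"
  shows "card S \<le> 2 ^ m"
proof -
  obtain U where U: "lagrangian V U" "S \<subseteq> U" using isotropic_extends[OF assms] .
  then have "finite U"
    using assms(1) lagrangian_subspace subspaceD(1) symplecticD(1) by blast
  with U card_lagrangian[OF assms(1) U(1)] show ?thesis by (metis card_mono)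
qed

lemma card_lagrangian_affine:
  assumes V: "symplectic V (Suc m)" and U: "lagrangian V U"
  shows "card {u \<in> U. form x u = 1} \<le> 2 ^ m"
proof (cases "\<exists>u\<in>U. form x u = 1")
  case True
  then obtain u where "u \<in> U" "form x u = 1" by auto
  from card_half[OF lagrangian_subspace[OF symplecticD(1)[OF V] U] this, of 1]
  show ?thesis using card_lagrangian[OF V U] by simp
next
  case False
  then have "{u \<in> U. form x u = 1} = {}" by auto
  then show ?thesis by (metis card.empty le0)
qed

text \<open>Extending to a Lagrangian first and cutting by \<open>form x s = 1\<close> afterwards
  gains a factor of two over \<open>card_isotropic\<close>. This is what bounds degrees in
  \<open>card_neighbours\<close>.\<close>

lemma card_isotropic_affine:
  assumes V: "symplectic V (Suc m)" and S: "S \<subseteq> V" "isotropic S"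
    and x: "\<And>s. s \<in> S \<Longrightarrow> form x s = 1"
  shows "card S \<le> 2 ^ m"
proof -
  obtain U where U: "lagrangian V U" "S \<subseteq> U" using isotropic_extends[OF V S] .
  then have "finite U"
    using V lagrangian_subspace subspaceD(1) symplecticD(1) by blast
  then have "card S \<le> card {u \<in> U. form x u = 1}" using U x by (intro card_mono) auto
  with card_lagrangian_affine[OF V U(1)] show ?thesis using le_trans by blast
qed

lemma card_neighbours:
  assumes "symplectic V (Suc m)" "A \<subseteq> V" "triangle_free A" "x \<in> A"
  shows "card {a \<in> A. form x a = 1} \<le> 2 ^ m"
  by (rule card_isotropic_affine[OF assms(1) _ isotropic_neighbours[OF assms(3,4)]])
    (use assms(2) in auto)

lemma card_edge_cover:
  "card A \<le> card {a \<in> A. form x a = 1} + card {a \<in> A. form y a = 1} +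
     card {a \<in> A. form x a = 0 \<and> form y a = 0}" (is "_ \<le> card ?X + card ?Y + card ?R")
proof -
  have "card A = card (?X \<union> ?Y \<union> ?R)" by (rule arg_cong[of _ _ card]) auto
  then show ?thesis
    using card_Un_le[of "?X \<union> ?Y" ?R] card_Un_le[of ?X ?Y] by linarith
qed

text \<open>The deficit 2 passes unchanged through the induction:
  \<open>2 * 2 ^ m + (2 ^ (m + 1) - 2) = 2 ^ (m + 2) - 2\<close>. Two Lagrangians meeting only in 0,
  with 0 removed, attain the bound.\<close>

theorem card_triangle_free:
  assumes "symplectic V m" "A \<subseteq> V - {0}" "triangle_free A"
  shows "card A + 2 \<le> 2 ^ (m + 1)"
  using assms
proof (induction m arbitrary: V A)
  case 0
  then have "card V = 1" "0 \<in> V" using symplecticD subspaceD by fastforce+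
  then have "V = {0}" by (metis card_1_singletonE singletonD)
  then show ?case using 0 by auto
next
  case (Suc m)
  have "finite V" using Suc.prems symplecticD subspaceD by blast
  then have fin: "finite A" using Suc.prems(2) by (meson finite_Diff finite_subset)
  show ?case
  proof (cases "isotropic A")
    case True
    then have "isotropic (insert 0 A)" by (auto simp: isotropic_def)
    moreover have "insert 0 A \<subseteq> V"
      using Suc.prems symplecticD(1) subspaceD(2) by blast
    ultimately have "card (insert 0 A) \<le> 2 ^ Suc m"
      using card_isotropic[OF Suc.prems(1)] by blast
    then have "card A + 1 \<le> 2 ^ Suc m" using fin Suc.prems(2) by (subst (asm) card_insert_disjoint) auto
    moreover have "(2::nat) ^ Suc m \<ge> 2" by simp
    ultimately show ?thesis by simp
  next
    case False
    then obtain x y where x: "x \<in> A" and y: "y \<in> A" and xy: "form x y = 1"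
      by (auto simp: isotropic_def)
    let ?V = "{z \<in> V. form x z = 0 \<and> form y z = 0}"
    let ?R = "{a \<in> A. form x a = 0 \<and> form y a = 0}"
    have "symplectic ?V m"
      using symplectic_perp_pair[OF Suc.prems(1)] x y xy Suc.prems(2) by blast
    moreover have "?R \<subseteq> ?V - {0}" using Suc.prems(2) by auto
    moreover have "triangle_free ?R" using triangle_free_subset[OF Suc.prems(3)] by auto
    ultimately have R: "card ?R + 2 \<le> 2 ^ (m + 1)" using Suc.IH by blast
    note card_edge_cover[of A x y]
    moreover have "A \<subseteq> V" using Suc.prems(2) by auto
    then have "card {a \<in> A. form x a = 1} \<le> 2 ^ m" "card {a \<in> A. form y a = 1} \<le> 2 ^ m"
      using card_neighbours[OF Suc.prems(1) _ Suc.prems(3)] x y by auto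
    ultimately show ?thesis using R by simp
  qed
qed


section \<open>Large triangle-free sets lie in two Lagrangians\<close>

text \<open>The neighbours of \<open>c0\<close> span an isotropic subspace containing \<open>c1\<close> and \<open>c4\<close>.  Adding
  \<open>c1 + c4\<close> to a vertex whose only neighbour on the pentagon is \<open>c0\<close> gives a vector of that
  subspace orthogonal to neither \<open>c2\<close> nor \<open>c3\<close>, hence outside \<open>A\<close>.\<close>

lemma pentagon_weight:
  assumes V: "symplectic V (Suc m)" and A: "A \<subseteq> V" "triangle_free A"
    and c: "c0 \<in> A" "c1 \<in> A" "c2 \<in> A" "c3 \<in> A" "c4 \<in> A"
    and edges: "form c0 c1 = 1" "form c1 c2 = 1" "form c2 c3 = 1" "form c3 c4 = 1" "form c4 c0 = 1"
  shows "card {a \<in> A. form c0 a = 1} +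
    card {a \<in> A. form c0 a = 1 \<and> form c2 a = 0 \<and> form c3 a = 0} \<le> 2 ^ m"
    (is "card ?N + card ?T \<le> _")
proof -
  have iso: "isotropic ?N" using isotropic_neighbours A(2) c(1) by blast
  have "?N \<subseteq> V" using A by auto
  then obtain U where U: "lagrangian V U" "?N \<subseteq> U"
    using isotropic_extends[OF V _ iso] by auto
  have subU: "subspace U" using lagrangian_subspace[OF symplecticD(1)[OF V] U(1)] .
  have e4: "form c0 c4 = 1" using edges(5) form_sym by metis
  have cU: "c1 \<in> U" "c4 \<in> U" using U(2) c edges e4 by auto
  have e: "form c2 c1 = 1" "form c2 c4 = 0" "form c3 c1 = 0"
    using triangle_freeD[OF A(2) c(3,4,5) edges(3,4)]
      triangle_freeD[OF A(2) c(2,3,4) edges(2,3)] edges(2) form_sym by metis+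
  let ?s = "\<lambda>a. a + (c1 + c4)"
  have val: "form c0 (?s a) = 1" "form c2 (?s a) = 1" "form c3 (?s a) = 1" "?s a \<in> U"
    if "a \<in> ?T" for a
    using that edges e e4 U(2) cU subspaceD(3)[OF subU] by (auto simp: form_add_right)
  have disj: "?N \<inter> ?s ` ?T = {}"
  proof (rule ccontr)
    assume "\<not> ?thesis"
    then obtain a where a: "?s a \<in> A" "a \<in> ?T" by auto
    have "form c2 (?s a) = 0"
      by (rule triangle_freeD[OF A(2) c(3,4) a(1) edges(3) val(3)[OF a(2)]])
    then show False using val(2)[OF a(2)] by simp
  qed
  have sub: "?N \<union> ?s ` ?T \<subseteq> {u \<in> U. form c0 u = 1}"
    using U(2) val by auto
  have fin: "finite {u \<in> U. form c0 u = 1}" using subspaceD(1)[OF subU] by simp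
  have "card ?N + card ?T = card ?N + card (?s ` ?T)"
    by (subst card_image) (auto simp: inj_on_def)
  also have "\<dots> = card (?N \<union> ?s ` ?T)"
    by (rule card_Un_disjoint[symmetric, OF _ _ disj]) (use sub finite_subset[OF _ fin] in auto)
  also have "\<dots> \<le> card {u \<in> U. form c0 u = 1}" by (rule card_mono[OF fin sub])
  also have "\<dots> \<le> 2 ^ m" by (rule card_lagrangian_affine[OF V U(1)])
  finally show ?thesis .
qed

lemma card_filter_sum:
  "finite A \<Longrightarrow> card {a \<in> A. P a} = (\<Sum>a\<in>A. of_bool (P a))"
proof -
  have "{a \<in> A. P a} = A \<inter> {a. P a}" by blast
  then show "finite A \<Longrightarrow> ?thesis" by (metis of_nat_id sum_of_bool_eq)
qed

text \<open>Every vertex with a neighbour on the pentagon has weight at least two: either it has two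
  such neighbours, or its only one counts double.\<close>

lemma pentagon_indicator:
  fixes p0 p1 p2 p3 p4 :: bit
  shows "2 * of_bool (p0 = 1 \<or> p1 = 1 \<or> p2 = 1 \<or> p3 = 1 \<or> p4 = 1) \<le>
    (of_bool (p0 = 1) + of_bool (p0 = 1 \<and> p2 = 0 \<and> p3 = 0)) +
    (of_bool (p1 = 1) + of_bool (p1 = 1 \<and> p3 = 0 \<and> p4 = 0)) +
    (of_bool (p2 = 1) + of_bool (p2 = 1 \<and> p4 = 0 \<and> p0 = 0)) +
    (of_bool (p3 = 1) + of_bool (p3 = 1 \<and> p0 = 0 \<and> p1 = 0)) +
    (of_bool (p4 = 1) + of_bool (p4 = 1 \<and> p1 = 0 \<and> p2 = 0) :: nat)"
  by (cases p0; cases p1; cases p2; cases p3; cases p4) simp_all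

text \<open>The five weights are at most \<open>2 ^ (k + 1)\<close> each and count every vertex
  adjacent to the pentagon at least twice, so there are at most \<open>5 * 2 ^ k\<close> of these.
  All others lie in a symplectic space of index \<open>k\<close>, which allows
  \<open>2 * 2 ^ k - 2\<close> more.\<close>

lemma card_pentagon:
  assumes V: "symplectic V (Suc (Suc k))" and A: "A \<subseteq> V - {0}" "triangle_free A"
    and c: "c0 \<in> A" "c1 \<in> A" "c2 \<in> A" "c3 \<in> A" "c4 \<in> A"
    and edges: "form c0 c1 = 1" "form c1 c2 = 1" "form c2 c3 = 1" "form c3 c4 = 1" "form c4 c0 = 1"
  shows "card A + 2 \<le> 7 * 2 ^ k"
proof -
  have AV: "A \<subseteq> V" using A by auto
  have fin: "finite A" using finite_subset[OF AV] symplecticD(1)[OF V] subspaceD(1) by blast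
  let ?Z = "{a \<in> A. form c0 a = 0 \<and> form c1 a = 0 \<and> form c2 a = 0 \<and> form c3 a = 0 \<and> form c4 a = 0}"
  let ?X = "{a \<in> A. form c0 a = 1 \<or> form c1 a = 1 \<or> form c2 a = 1 \<or> form c3 a = 1 \<or> form c4 a = 1}"
  let ?N = "\<lambda>x. card {a \<in> A. form x a = 1}"
  let ?T = "\<lambda>x y z. card {a \<in> A. form x a = 1 \<and> form y a = 0 \<and> form z a = 0}"
  note weight = pentagon_weight[OF V AV A(2)]
  have w: "?N c0 + ?T c0 c2 c3 \<le> 2 ^ Suc k" "?N c1 + ?T c1 c3 c4 \<le> 2 ^ Suc k"
     "?N c2 + ?T c2 c4 c0 \<le> 2 ^ Suc k" "?N c3 + ?T c3 c0 c1 \<le> 2 ^ Suc k"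
     "?N c4 + ?T c4 c1 c2 \<le> 2 ^ Suc k"
    by (rule weight[OF c edges], rule weight[OF c(2,3,4,5,1) edges(2,3,4,5,1)],
        rule weight[OF c(3,4,5,1,2) edges(3,4,5,1,2)],
        rule weight[OF c(4,5,1,2,3) edges(4,5,1,2,3)],
        rule weight[OF c(5,1,2,3,4) edges(5,1,2,3,4)])
  have "2 * card ?X \<le> (?N c0 + ?T c0 c2 c3) + (?N c1 + ?T c1 c3 c4) + (?N c2 + ?T c2 c4 c0)
      + (?N c3 + ?T c3 c0 c1) + (?N c4 + ?T c4 c1 c2)"
    unfolding card_filter_sum[OF fin] sum_distrib_left sum.distrib[symmetric]
    by (rule sum_mono) (rule pentagon_indicator)
  also have "\<dots> \<le> 2 ^ Suc k + 2 ^ Suc k + 2 ^ Suc k + 2 ^ Suc k + 2 ^ Suc k"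
    by (intro add_mono w)
  finally have X: "2 * card ?X \<le> 10 * 2 ^ k" by simp
  have c02: "form c0 c2 = 0" "form c1 c3 = 0" "form c0 c3 = 0"
    using triangle_freeD[OF A(2) c(1,2,3) edges(1,2)]
      triangle_freeD[OF A(2) c(2,3,4) edges(2,3)]
      triangle_freeD[OF A(2) c(4,5,1) edges(4,5)] form_sym by metis+
  have c': "c0 \<in> V" "c1 \<in> V" "c2 \<in> V" "c3 \<in> V" using c AV by auto
  have e': "form c1 c0 = 1" "form c0 c0 = 0"
    using edges(1) form_sym symplecticD(3)[OF V] c' by metis+
  let ?V1 = "{z \<in> V. form c0 z = 0 \<and> form c1 z = 0}"
  (* c2 + c0 and c3 are orthogonal to c0 and c1 but not to each other. *)
  let ?V2 = "{z \<in> ?V1. form (c2 + c0) z = 0 \<and> form c3 z = 0}"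
  have V1: "symplectic ?V1 (Suc k)"
    by (rule symplectic_perp_pair[OF V c'(1,2) edges(1)])
  have "c2 + c0 \<in> ?V1"
    using c' c02 e' edges subspaceD(3)[OF symplecticD(1)[OF V]] by (simp add: form_add_right)
  moreover have "c3 \<in> ?V1" using c' c02 by simp
  moreover have "form (c2 + c0) c3 = 1" using edges c02 by (simp add: form_add)
  ultimately have "symplectic ?V2 k" by (rule symplectic_perp_pair[OF V1])
  moreover have "?Z \<subseteq> ?V2 - {0}" using A(1) by (auto simp: form_add)
  moreover have "triangle_free ?Z" by (rule triangle_free_subset[OF A(2)]) auto
  ultimately have Z: "card ?Z + 2 \<le> 2 ^ (k + 1)" by (rule card_triangle_free)
  have "card A = card (?X \<union> ?Z)" by (rule arg_cong[of _ _ card]) auto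
  then have "card A \<le> card ?X + card ?Z" using card_Un_le[of ?X ?Z] by linarith
  moreover have "(2::nat) ^ (k + 1) = 2 * 2 ^ k" by simp
  moreover have "a + 2 \<le> 7 * p" if "a \<le> x + z" "q = 2 * p" "2 * x \<le> 10 * p" "z + 2 \<le> q"
    for a x z p q :: nat using that by linarith
  ultimately show ?thesis using X Z by blast
qed

text \<open>If \<open>A\<close> has an edge, \<open>U\<close> is chosen to contain the neighbourhood
  of a vertex of large degree; \<open>A - U\<close> then turns out to be isotropic and is extended
  to \<open>W\<close>.\<close>

theorem triangle_free_stability:
  assumes V: "symplectic V (Suc (Suc k))" and A: "A \<subseteq> V - {0}" "triangle_free A"
    and large: "7 * 2 ^ k < card A + 2"
  obtains U W where "lagrangian V U" "lagrangian V W" "A \<subseteq> U \<union> W"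
proof -
  have AV: "A \<subseteq> V" using A by auto
  have fin: "finite A" using finite_subset[OF AV] symplecticD(1)[OF V] subspaceD(1) by blast
  show thesis
  proof (cases "isotropic A")
    case True
    obtain U where "lagrangian V U" "A \<subseteq> U" using isotropic_extends[OF V AV True] .
    then show thesis using that[of U U] by simp
  next
    case False
    then obtain x0 y0 where xy0: "x0 \<in> A" "y0 \<in> A" "form x0 y0 = 1"
      by (auto simp: isotropic_def)
    let ?N = "\<lambda>x. {a \<in> A. form x a = 1}"
    \<comment> \<open>If all degrees were at most \<open>2 ^ k\<close>, covering \<open>A\<close> by
      the edge \<open>x0 y0\<close> would give \<open>card A + 2 <= 2 * 2 ^ k + 4 * 2 ^ k\<close>,
      below the threshold.\<close>
    obtain x where x: "x \<in> A" "card (?N x) > 2 ^ k"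
    proof (rule ccontr)
      assume "\<not> thesis"
      with that have small: "card (?N x) \<le> 2 ^ k" if "x \<in> A" for x
        using that by (meson not_le)
      let ?V = "{z \<in> V. form x0 z = 0 \<and> form y0 z = 0}"
      let ?R = "{a \<in> A. form x0 a = 0 \<and> form y0 a = 0}"
      have "symplectic ?V (Suc k)"
        using symplectic_perp_pair[OF V] xy0 AV by blast
      moreover have "?R \<subseteq> ?V - {0}" using A by auto
      moreover have "triangle_free ?R" by (rule triangle_free_subset[OF A(2)]) auto
      ultimately have "card ?R + 2 \<le> 2 ^ (Suc k + 1)" by (rule card_triangle_free)
      moreover have "(2::nat) ^ (Suc k + 1) = 4 * 2 ^ k" by simp
      moreover note card_edge_cover[of A x0 y0] small[OF xy0(1)] small[OF xy0(2)] large
      ultimately show False by linarith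
    qed
    have "?N x \<subseteq> V" using AV by auto
    then obtain U where U: "lagrangian V U" "?N x \<subseteq> U"
      using isotropic_extends[OF V _ isotropic_neighbours[OF A(2) x(1)]] by auto
    have subU: "subspace U" using lagrangian_subspace[OF symplecticD(1)[OF V] U(1)] .
    (* N(x) is more than half of an affine half of U, so only vectors of U are orthogonal to it. *)
    have nbr: "\<exists>a\<in>?N x. form a d = 1" if d: "d \<in> A" "d \<notin> U" for d
    proof (rule ccontr)
      assume "\<not> ?thesis"
      then have "\<forall>a\<in>?N x. form a d = 0" by auto
      then have N: "form d a = 0" if "a \<in> ?N x" for a
        using that by (simp add: form_sym[of d a])
      let ?U = "{u \<in> U. form d u = 0}"
      obtain u where "u \<in> U" "form d u = 1" using lagrangianD(3)[OF U(1)] d AV by blast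
      then have "2 * card ?U = card U" by (rule card_half[OF subU])
      moreover have "?N x \<noteq> {}" using x(2) by (metis card.empty not_less_zero)
      then obtain v where "v \<in> ?N x" by auto
      then have "v \<in> ?U" "form x v = 1" using N U(2) by auto
      then have "2 * card {u \<in> ?U. form x u = 1} = card ?U"
        by (rule card_half[OF subspace_perp[OF subU]])
      moreover have "(2::nat) ^ Suc (Suc k) = 4 * 2 ^ k" by simp
      ultimately have "card {u \<in> ?U. form x u = 1} = 2 ^ k"
        using card_lagrangian[OF V U(1)] by linarith
      moreover have "card (?N x) \<le> card {u \<in> ?U. form x u = 1}"
        by (rule card_mono) (use subspaceD(1)[OF subU] N U(2) in auto)
      ultimately show False using x(2) by linarith
    qed
    (* An edge de outside U would close up to a pentagon x a d e b. *)
    have "form d e = 0" if d: "d \<in> A - U" and e: "e \<in> A - U" for d e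
    proof (rule ccontr)
      assume "form d e \<noteq> 0"
      then have de: "form d e = 1" by simp
      from nbr d obtain a where a: "a \<in> A" "form x a = 1" "form a d = 1" by blast
      from nbr e obtain b where b: "b \<in> A" "form x b = 1" "form b e = 1" by blast
      have "form e b = 1" "form b x = 1" using b form_sym by metis+
      with card_pentagon[OF V A x(1) a(1) _ _ b(1) a(2,3) de] d e large
      show False by simp
    qed
    then have "isotropic (A - U)" by (simp add: isotropic_def)
    moreover have "A - U \<subseteq> V" using AV by auto
    ultimately obtain W where W: "lagrangian V W" "A - U \<subseteq> W"
      using isotropic_extends[OF V] by metis
    then show thesis using that[OF U(1) W(1)] by blast
  qed
qed

text \<open>Both functionals are nonzero on \<open>W\<close>. If they agree the set is half of
  \<open>W\<close>, otherwise a quarter. Both cases are covered by noting that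
  \<open>form y w = 1\<close> holds on at most half of the vectors with
  \<open>form x w = 0\<close>.\<close>

lemma card_common_neighbours:
  assumes W: "subspace W" and x: "u \<in> W" "form x u = 1" and y: "v \<in> W" "form y v = 1"
  shows "card W \<le> 4 * card {w \<in> W. form x w = 1 \<and> form y w = 1}"
proof -
  let ?X = "{w \<in> W. form x w = 0}" and ?Y = "{w \<in> W. form y w = 1}"
  have X: "2 * card ?X = card W" by (rule card_half[OF W x])
  have Y: "2 * card ?Y = card W" by (rule card_half[OF W y])
  have "finite ?Y" using subspaceD(1)[OF W] by simp
  from card_split[OF this, of x]
  have "card ?Y = card {w \<in> ?X. form y w = 1} + card {w \<in> W. form x w = 1 \<and> form y w = 1}"
    by (simp add: conj_ac)
  moreover have "2 * card {w \<in> ?X. form y w = 1} \<le> card ?X"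
  proof (cases "\<exists>w\<in>?X. form y w = 1")
    case True
    then obtain w where "w \<in> ?X" "form y w = 1" by blast
    from card_half[OF subspace_perp[OF W] this, of 1] show ?thesis by linarith
  next
    case False
    then have "{w \<in> ?X. form y w = 1} = {}" by blast
    then show ?thesis by (metis card.empty mult_0_right le0)
  qed
  ultimately show ?thesis using X Y by linarith
qed

section \<open>Adding vectors that are not self-orthogonal\<close>

text \<open>Distinctness discards loops: under the dot product a vector can have
  \<open>form x x = 1\<close>. This is the shape in which \<open>three_two_orthogonal\<close> is
  transferred.\<close>

definition loopless_triangle_free :: "'a set \<Rightarrow> bool" where
  "loopless_triangle_free S \<longleftrightarrow>
     (\<forall>x\<in>S. \<forall>y\<in>S. \<forall>z\<in>S. x \<noteq> y \<longrightarrow> x \<noteq> z \<longrightarrow> y \<noteq> z \<longrightarrow>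
        form x y = 1 \<longrightarrow> form x z = 1 \<longrightarrow> form y z = 0)"

lemma loopless_triangle_freeD:
  "loopless_triangle_free S \<Longrightarrow> x \<in> S \<Longrightarrow> y \<in> S \<Longrightarrow> z \<in> S \<Longrightarrow> x \<noteq> y \<Longrightarrow> x \<noteq> z \<Longrightarrow> y \<noteq> z \<Longrightarrow>
     form x y = 1 \<Longrightarrow> form x z = 1 \<Longrightarrow> form y z = 0"
  unfolding loopless_triangle_free_def by blast

lemma loopless_triangle_free_subset:
  "loopless_triangle_free S \<Longrightarrow> T \<subseteq> S \<Longrightarrow> loopless_triangle_free T"
  unfolding loopless_triangle_free_def by blast

text \<open>With \<open>form x x = 0\<close> on \<open>S\<close>, adjacent vectors are automatically
  distinct, and the case \<open>x = z\<close> gives the value 0.\<close>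

lemma loopless_triangle_free_alternating:
  assumes S: "loopless_triangle_free S" and alt: "\<And>x. x \<in> S \<Longrightarrow> form x x = 0"
  shows "triangle_free S"
proof -
  have "form x z = 0" if "x \<in> S" "y \<in> S" "z \<in> S" "form x y = 1" "form y z = 1" for x y z
  proof (cases "x = z")
    case False
    have "x \<noteq> y" "y \<noteq> z" using that alt by auto
    with False that show ?thesis
      using loopless_triangle_freeD[OF S that(2,1,3)] form_sym by metis
  qed (use that alt in simp)
  then show ?thesis unfolding triangle_free_def by blast
qed

text \<open>The perp of one member is half of \<open>V\<close> and still contains all other members.
  The bound on \<open>card V\<close> stands in for a dimension.\<close>

lemma card_orthonormal:
  assumes "subspace V" "card V \<le> 2 ^ k" "S \<subseteq> V"
    and "\<And>x. x \<in> S \<Longrightarrow> form x x = 1"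
    and "\<And>x y. x \<in> S \<Longrightarrow> y \<in> S \<Longrightarrow> x \<noteq> y \<Longrightarrow> form x y = 0"
  shows "card S \<le> k"
  using assms
proof (induction k arbitrary: V S)
  case 0
  have "S = {}"
  proof (rule ccontr)
    assume "S \<noteq> {}"
    then obtain x where x: "x \<in> S" by blast
    with 0 have "{0, x} \<subseteq> V" "x \<noteq> 0" using subspaceD(2) by fastforce+
    then have "card {0, x} \<le> card V" using 0(1) subspaceD(1) by (metis card_mono)
    then show False using 0(2) \<open>x \<noteq> 0\<close> by simp
  qed
  then show ?case by simp
next
  case (Suc k)
  show ?case
  proof (cases "S = {}")
    case False
    then obtain x where x: "x \<in> S" by blast
    let ?V = "{u \<in> V. form x u = 0}"
    have "2 * card ?V = card V"
      by (rule card_half[OF Suc.prems(1), of x]) (use x Suc.prems in auto)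
    then have "card ?V \<le> 2 ^ k" using Suc.prems(2) by simp
    moreover have "S - {x} \<subseteq> ?V" using x Suc.prems(3,5) by blast
    ultimately have "card (S - {x}) \<le> k"
      by (intro Suc.IH[OF subspace_perp[OF Suc.prems(1)]]) (use Suc.prems(4,5) in auto)
    then show ?thesis by (simp add: card_Diff_singleton x)
  qed simp
qed

text \<open>Fix \<open>x\<close> in \<open>S\<close>. Its non-neighbours lie in the perp of
  \<open>x\<close>; its neighbours other than \<open>x\<close> itself are orthonormal, hence at most
  \<open>k + 1\<close>. The recursion \<open>T (k + 1) = T k + k + 2\<close> has the solution
  \<open>k * (k + 3) / 2\<close>.\<close>

theorem card_nonisotropic_triangle_free:
  assumes "subspace V" "card V \<le> 2 ^ k" "S \<subseteq> V"
    and "\<And>x. x \<in> S \<Longrightarrow> form x x = 1" and "loopless_triangle_free S"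
  shows "2 * card S \<le> k * (k + 3)"
  using assms
proof (induction k arbitrary: V S)
  case 0
  have "card S \<le> 0"
  proof (rule card_orthonormal[OF 0(1-4)])
    fix x y assume "x \<in> S" "y \<in> S" "x \<noteq> y"
    have "card V = 1" using 0(1,2) subspaceD[OF 0(1)]
      by (metis card_gt_0_iff empty_iff le_antisym less_eq_Suc_le One_nat_def power_0)
    then show "form x y = 0"
      using \<open>x \<in> S\<close> \<open>y \<in> S\<close> \<open>x \<noteq> y\<close> 0(3) by (metis card_1_singletonE singletonD subsetD)
  qed
  then show ?case by simp
next
  case (Suc k)
  have fin: "finite S" using Suc.prems(1,3) subspaceD(1) finite_subset by blast
  show ?case
  proof (cases "S = {}")
    case False
    then obtain x where x: "x \<in> S" by blast
    let ?V = "{u \<in> V. form x u = 0}"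
    let ?P = "{u \<in> S. form x u = 0}" and ?Q = "{u \<in> S. form x u = 1} - {x}"
    have "2 * card ?V = card V"
      by (rule card_half[OF Suc.prems(1), of x]) (use x Suc.prems in auto)
    then have "card ?V \<le> 2 ^ k" using Suc.prems(2) by simp
    moreover have "loopless_triangle_free ?P"
      by (rule loopless_triangle_free_subset[OF Suc.prems(5)]) blast
    ultimately have P: "2 * card ?P \<le> k * (k + 3)"
      by (intro Suc.IH[OF subspace_perp[OF Suc.prems(1)]]) (use Suc.prems(3,4) in auto)
    have Q: "card ?Q \<le> Suc k"
      by (rule card_orthonormal[OF Suc.prems(1,2)])
        (use Suc.prems(3,4) loopless_triangle_freeD[OF Suc.prems(5) x] in auto)
    have "card ?Q = card {u \<in> S. form x u = 1} - 1"
      by (rule card_Diff_singleton) (use x Suc.prems(4) in simp)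
    then have "card S \<le> card ?P + card ?Q + 1"
      using card_split[OF fin, of x] by linarith
    moreover have "2 * s \<le> q + 2 * k + 4" if "s \<le> p + r + 1" "2 * p \<le> q" "r \<le> Suc k"
      for s p q r :: nat using that by simp
    ultimately have "2 * card S \<le> k * (k + 3) + 2 * k + 4" using P Q by blast
    then show ?thesis by (simp add: algebra_simps)
  qed simp
qed

section \<open>Self-orthogonal and other vectors together, in odd and even dimension\<close>

lemma card_le_two:
  assumes "finite X"
    and "\<And>x y z. x \<in> X \<Longrightarrow> y \<in> X \<Longrightarrow> z \<in> X \<Longrightarrow> x \<noteq> y \<Longrightarrow> x \<noteq> z \<Longrightarrow> y \<noteq> z \<Longrightarrow> False"
  shows "card X \<le> 2"
proof (rule ccontr)
  assume "\<not> ?thesis"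
  then have "3 \<le> card X" by simp
  then obtain T where "T \<subseteq> X" "card T = 3" by (rule obtain_subset_with_card_n)
  then show False using assms(2) unfolding card_3_iff by blast
qed

text \<open>\<open>B\<close> stands for the vectors that are not self-orthogonal, translated into \<open>V\<close> by the
  all-ones vector.  The translation complements the form on \<open>B\<close>, so edges inside \<open>B\<close> are the pairs with value 0.\<close>

lemma card_mixed:
  assumes V: "symplectic V (Suc (Suc k))" and A: "A \<subseteq> V - {0}" "triangle_free A" and B: "B \<subseteq> V"
    and AAB: "\<And>b a a'. b \<in> B \<Longrightarrow> a \<in> A \<Longrightarrow> a' \<in> A \<Longrightarrow> form b a = 1 \<Longrightarrow> form b a' = 1 \<Longrightarrow> form a a' = 0"
    and ABB: "\<And>a b b'. a \<in> A \<Longrightarrow> b \<in> B \<Longrightarrow> b' \<in> B \<Longrightarrow> b \<noteq> b' \<Longrightarrow> form b b' = 0 \<Longrightarrow> form b a = 1 \<Longrightarrow>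
      form b' a = 0"
    and BBB: "\<And>x y z. x \<in> B \<Longrightarrow> y \<in> B \<Longrightarrow> z \<in> B \<Longrightarrow> x \<noteq> y \<Longrightarrow> x \<noteq> z \<Longrightarrow> y \<noteq> z \<Longrightarrow>
      form x y = 0 \<Longrightarrow> form x z = 0 \<Longrightarrow> form y z = 1"
    and card_B: "card B \<ge> 4"
  shows "card A + 2 \<le> 7 * 2 ^ k"
proof (rule ccontr)
  assume "\<not> ?thesis"
  then have large: "7 * 2 ^ k < card A + 2" by simp
  from triangle_free_stability[OF V A large] obtain U W
    where U: "lagrangian V U" and W: "lagrangian V W" and AUW: "A \<subseteq> U \<union> W" .
  have pow: "(2::nat) ^ Suc (Suc k) = 4 * 2 ^ k" "(2::nat) ^ Suc k = 2 * 2 ^ k" by simp_all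
  have subV: "subspace V" by (rule symplecticD(1)[OF V])
  have subs: "subspace U" "subspace W" using lagrangian_subspace[OF subV] U W by blast+
  have cards: "card U = 4 * 2 ^ k" "card W = 4 * 2 ^ k"
    using card_lagrangian[OF V] U W pow by simp_all
  have fins: "finite U" "finite W" using subs subspaceD(1) by blast+
  have finB: "finite B" using finite_subset[OF B subspaceD(1)[OF subV]] .
  \<comment> \<open>Otherwise the neighbours of \<open>b\<close> number at most
    \<open>2 * 2 ^ k\<close>, and its perp meets \<open>U\<close> and \<open>W\<close> in
    \<open>2 * 2 ^ k - 1\<close> nonzero vectors each: \<open>6 * 2 ^ k - 2\<close> in all, too
    few.\<close>
  have BUW: "b \<in> U \<or> b \<in> W" if b: "b \<in> B" for b
  proof (rule ccontr)
    assume notin: "\<not> ?thesis"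
    have bV: "b \<in> V" using b B by blast
    let ?N = "{a \<in> A. form b a = 1}"
    let ?P = "\<lambda>X. {u \<in> X. form b u = 0} - {0}"
    have half: "card (?P X) + 1 = 2 * 2 ^ k"
      if X: "lagrangian V X" "b \<notin> X" "subspace X" "card X = 4 * 2 ^ k" for X
    proof -
      obtain u where "u \<in> X" "form b u = 1" using lagrangianD(3)[OF X(1) bV X(2)] by blast
      then have "2 * card {u \<in> X. form b u = 0} = card X" by (rule card_half[OF X(3)])
      moreover have "card {u \<in> X. form b u = 0} = Suc (card (?P X))"
        by (rule card.remove) (use subspaceD[OF X(3)] in auto)
      ultimately show ?thesis using X(4) by linarith
    qed
    have "card ?N \<le> 2 ^ Suc k"
    proof (rule card_isotropic_affine[OF V])
      show "isotropic ?N" unfolding isotropic_def using AAB[OF b] by blast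
    qed (use A in auto)
    moreover have "A \<subseteq> ?N \<union> ?P U \<union> ?P W" using AUW A by auto
    then have "card A \<le> card (?N \<union> ?P U \<union> ?P W)"
      by (rule card_mono[rotated]) (use fins finite_subset[OF AUW] in auto)
    then have "card A \<le> card ?N + card (?P U) + card (?P W)"
      using card_Un_le[of "?N \<union> ?P U" "?P W"] card_Un_le[of ?N "?P U"] by linarith
    moreover have "card (?P U) + 1 = 2 * 2 ^ k" "card (?P W) + 1 = 2 * 2 ^ k"
      using half U W subs cards notin by blast+
    ultimately show False using large pow by linarith
  qed
  \<comment> \<open>Value 0 is adjacency inside \<open>B\<close>, so three vectors of
    \<open>B\<close> in one Lagrangian would form a triangle.\<close>
  have le2: "card (B \<inter> X) \<le> 2" if X: "lagrangian V X" for X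
  proof (rule card_le_two)
    fix x y z assume *: "x \<in> B \<inter> X" "y \<in> B \<inter> X" "z \<in> B \<inter> X" "x \<noteq> y" "x \<noteq> z" "y \<noteq> z"
    then have "form x y = 0" "form x z = 0" "form y z = 0" using lagrangianD(2)[OF X] by blast+
    then show False using BBB[of x y z] * by simp
  qed (use finB in simp)
  \<comment> \<open>Four vectors, at most two in each Lagrangian: exactly two in \<open>U\<close>,
    and none in both.\<close>
  have "B = (B \<inter> U) \<union> (B \<inter> W)" using BUW by blast
  then have "card (B \<inter> U) + card (B \<inter> W) = card B + card ((B \<inter> U) \<inter> (B \<inter> W))"
    using card_Un_Int[of "B \<inter> U" "B \<inter> W"] finB by simp
  with le2[OF U] le2[OF W] card_B
  have "card (B \<inter> U) = 2" "card ((B \<inter> U) \<inter> (B \<inter> W)) = 0" by linarith+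
  then obtain b b' where bb: "B \<inter> U = {b, b'}" "b \<noteq> b'" and "(B \<inter> U) \<inter> (B \<inter> W) = {}"
    using finB by (auto simp: card_2_iff)
  then have b: "b \<in> B" "b' \<in> B" "b \<in> U" "b' \<in> U" "b \<notin> W" "b' \<notin> W" by blast+
  then have bV: "b \<in> V" "b' \<in> V" using B by blast+
  \<comment> \<open>The vectors \<open>b\<close> and \<open>b'\<close> are adjacent, so
    \<open>A\<close> avoids their common neighbours \<open>?L\<close>, at least a quarter of
    \<open>W\<close>. With 0 missing from both Lagrangians this leaves at most
    \<open>(4 * 2 ^ k - 1) + (3 * 2 ^ k - 1)\<close>.\<close>
  let ?L = "{w \<in> W. form b w = 1 \<and> form b' w = 1}"
  obtain u v where uv: "u \<in> W" "form b u = 1" "v \<in> W" "form b' v = 1"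
    using lagrangianD(3)[OF W bV(1) b(5)] lagrangianD(3)[OF W bV(2) b(6)] by blast
  have L: "card W \<le> 4 * card ?L" by (rule card_common_neighbours[OF subs(2) uv])
  have "form b b' = 0" using lagrangianD(2)[OF U] b by blast
  then have "form b' a = 0" if "a \<in> A" "form b a = 1" for a
    using ABB[OF that(1) b(1,2) bb(2)] that(2) by blast
  then have "A \<subseteq> (U - {0}) \<union> (W - insert 0 ?L)" using AUW A by auto
  then have "card A \<le> card ((U - {0}) \<union> (W - insert 0 ?L))"
    by (rule card_mono[rotated]) (use fins in simp)
  then have c1: "card A \<le> card (U - {0}) + card (W - insert 0 ?L)"
    using card_Un_le[of "U - {0}" "W - insert 0 ?L"] by (rule order_trans)
  have c2: "card U = Suc (card (U - {0}))"
    by (rule card.remove[OF fins(1) subspaceD(2)[OF subs(1)]])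
  have L0: "insert 0 ?L \<subseteq> W" using subspaceD(2)[OF subs(2)] by auto
  have "card (W - insert 0 ?L) = card W - card (insert 0 ?L)"
    by (rule card_Diff_subset[OF finite_subset[OF L0 fins(2)] L0])
  moreover have "card (insert 0 ?L) = Suc (card ?L)" by (rule card_insert_disjoint) (use fins(2) in auto)
  moreover have "card (insert 0 ?L) \<le> card W" by (rule card_mono[OF fins(2) L0])
  ultimately have c3: "card W = Suc (card ?L) + card (W - insert 0 ?L)" by presburger
  have "a + 2 \<le> 7 * r"
    if "a \<le> u + w" "p = Suc u" "q = Suc l + w" "q \<le> 4 * l" "p = 4 * r" "q = 4 * r"
    for a u w l p q r :: nat using that by linarith
  from this[OF c1 c2 c3 L cards] large show False by simp
qed

text \<open>Two cases balance. With at least four vectors in \<open>?C\<close>, the bounds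
  \<open>7 * 2 ^ k - 2\<close> on \<open>?A\<close> and \<open>2 ^ k + 3\<close> on
  \<open>?C\<close> add up to \<open>8 * 2 ^ k + 1\<close>; the hypothesis \<open>k\<close> supplies
  the second. With at most three, \<open>8 * 2 ^ k - 2\<close> and 3 give the same total.\<close>

theorem card_odd_dimension:
  assumes W: "subspace W" "card W = 2 ^ (2 * k + 5)"
    and nondeg: "\<And>x. x \<in> W \<Longrightarrow> x \<noteq> 0 \<Longrightarrow> \<exists>y\<in>W. form x y = 1"
    and J: "J \<in> W" "form J J = 1" "\<And>x. x \<in> W \<Longrightarrow> form x x = form J x"
    and S: "S \<subseteq> W - {0}" "loopless_triangle_free S"
    and k: "(2 * k + 5) * (2 * k + 8) \<le> 2 * (2 ^ k + 3)"
  shows "card S \<le> 2 ^ (k + 3) + 1"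
proof -
  let ?V = "{x \<in> W. form J x = 0}"
  let ?A = "{x \<in> S. form J x = 0}" and ?C = "{x \<in> S. form J x = 1}"
  have SW: "S \<subseteq> W" using S(1) by blast
  have A_alt: "form x x = 0" if "x \<in> ?A" for x using that SW J(3)[of x] by auto
  have C_one: "form x x = 1" if "x \<in> ?C" for x using that SW J(3)[of x] by auto
  have xJ: "form x J = form J x" for x by (rule form_sym)
  have fin: "finite S" using S(1) subspaceD(1)[OF W(1)] by (meson finite_Diff finite_subset)
  have V: "symplectic ?V (Suc (Suc k))"
    unfolding symplectic_def
  proof (intro conjI ballI impI)
    have "2 * card ?V = 2 ^ (2 * k + 5)" using card_half[OF W(1) J(1,2), of 0] W(2) by simp
    also have "\<dots> = 2 * 4 ^ Suc (Suc k)" by (simp add: power_add power_mult)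
    finally show "card ?V = 4 ^ Suc (Suc k)" by simp
    fix x assume x: "x \<in> ?V"
    then show "form x x = 0" using J(3)[of x] by simp
    assume orth: "\<forall>y\<in>?V. form x y = 0"
    show "x = 0"
    proof (rule ccontr)
      assume "x \<noteq> 0"
      then obtain y where y: "y \<in> W" "form x y = 1" using nondeg x by blast
      \<comment> \<open>Since \<open>form J J = 1\<close>, adding \<open>J\<close> corrects
        \<open>y\<close> into the perp of \<open>J\<close>; \<open>x\<close> is orthogonal to
        \<open>J\<close>, so its pairing with \<open>y\<close> survives.\<close>
      have "(if form J y = 1 then y + J else y) \<in> ?V"
        using y J(1,2) subspaceD(3)[OF W(1)] by (simp add: form_add_right)
      then have "form x (if form J y = 1 then y + J else y) = 0" using orth by blast
      moreover have "form x J = 0" using x xJ[of x] by simp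
      ultimately show False using y(2) by (simp add: form_add_right split: if_splits)
    qed
  qed (rule subspace_perp[OF W(1)])
  have A: "?A \<subseteq> ?V - {0}" using S(1) by blast
  have Atf: "triangle_free ?A"
  proof (rule loopless_triangle_free_alternating)
    show "loopless_triangle_free ?A" by (rule loopless_triangle_free_subset[OF S(2)]) blast
  qed (rule A_alt)
  let ?B = "(\<lambda>x. x + J) ` ?C"
  have card_B: "card ?B = card ?C" by (rule card_image) (simp add: inj_on_def)
  have "?B \<subseteq> ?V"
    using SW J(1,2) subspaceD(3)[OF W(1)] by (auto simp: form_add_right)
  note mixed = card_mixed[OF V A Atf this]
  have fCA: "form (c + J) a = form c a" if "a \<in> ?A" for a c
    using that by (simp add: form_add)
  \<comment> \<open>The three extra terms \<open>form c J\<close>, \<open>form J d\<close> and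
    \<open>form J J\<close> are all 1, so the form is complemented.\<close>
  have fCC: "form (c + J) (d + J) = form c d + 1" if "c \<in> ?C" "d \<in> ?C" for c d
    using that J(2) xJ[of c] by (simp add: form_add form_add_right)
  have "card ?A + 2 \<le> 7 * 2 ^ k" if "card ?C \<ge> 4"
  proof (rule mixed)
    fix b a a' assume *: "b \<in> ?B" "a \<in> ?A" "a' \<in> ?A" "form b a = 1" "form b a' = 1"
    then obtain c where c: "c \<in> ?C" "b = c + J" by blast
    with * have f: "form c a = 1" "form c a' = 1" using fCA by simp_all
    have "form a a = 0" by (rule A_alt[OF *(2)])
    moreover have "c \<noteq> a" "c \<noteq> a'" using c *(2,3) by auto
    ultimately show "form a a' = 0"
      using loopless_triangle_freeD[OF S(2) _ _ _ _ _ _ f] c *(2,3) by (cases "a = a'") auto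
  next
    fix a b b' assume *: "a \<in> ?A" "b \<in> ?B" "b' \<in> ?B" "b \<noteq> b'" "form b b' = 0" "form b a = 1"
    then obtain c d where c: "c \<in> ?C" "b = c + J" and d: "d \<in> ?C" "b' = d + J" by blast
    with * have f: "form c a = 1" "form c d = 1" using fCA fCC[of c d] by simp_all
    moreover have "c \<noteq> a" "d \<noteq> a" "c \<noteq> d" using c d * by auto
    ultimately have "form d a = 0"
      using loopless_triangle_freeD[OF S(2), of c d a] c d *(1) by simp
    then show "form b' a = 0" using fCA[OF *(1)] d by simp
  next
    fix x y z assume *: "x \<in> ?B" "y \<in> ?B" "z \<in> ?B" "x \<noteq> y" "x \<noteq> z" "y \<noteq> z"
      "form x y = 0" "form x z = 0"
    then obtain c d e where c: "c \<in> ?C" "x = c + J" and d: "d \<in> ?C" "y = d + J"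
      and e: "e \<in> ?C" "z = e + J" by blast
    with * have f: "form c d = 1" "form c e = 1" using fCC[of c d] fCC[of c e] by simp_all
    have "form d e = 0"
      using loopless_triangle_freeD[OF S(2) _ _ _ _ _ _ f] c d e * by auto
    then show "form y z = 1" using fCC[OF d(1) e(1)] d e by simp
  next
    show "card ?B \<ge> 4" using that card_B by simp
  qed
  moreover have "2 * card ?C \<le> (2 * k + 5) * ((2 * k + 5) + 3)"
  proof (rule card_nonisotropic_triangle_free[OF W(1)])
    show "loopless_triangle_free ?C" by (rule loopless_triangle_free_subset[OF S(2)]) blast
  qed (use W(2) SW C_one in auto)
  then have "2 * card ?C \<le> 2 * (2 ^ k + 3)" using k by (simp add: add.assoc)
  then have "card ?C \<le> 2 ^ k + 3" by simp
  moreover have "card ?A + 2 \<le> 8 * 2 ^ k"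
    using card_triangle_free[OF V A Atf] by simp
  moreover have "card S = card ?A + card ?C" by (rule card_split[OF fin])
  moreover have "(2::nat) ^ (k + 3) = 8 * 2 ^ k" by (simp add: power_add)
  ultimately show ?thesis by linarith
qed

text \<open>For \<open>form J b = 1\<close>, the perp of \<open>J\<close> is \<open>?V b\<close>
  plus the line of \<open>J\<close>, so \<open>?A\<close> splits into \<open>?P b\<close> inside
  \<open>?V b\<close> and \<open>?Q b\<close>, which translation by \<open>J\<close> moves there. If
  \<open>?C\<close> is empty the parts give \<open>2 * 2 ^ m - 2\<close> and
  \<open>2 * 2 ^ m - 1\<close>. Otherwise \<open>b\<close> is taken in \<open>?C\<close>, and
  \<open>?P b\<close>, \<open>?Q b\<close>, \<open>?C\<close> give \<open>2 * 2 ^ m - 2\<close>,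
  \<open>2 ^ m\<close> and \<open>2 ^ m - 1\<close>.\<close>

theorem card_even_dimension:
  assumes W: "subspace W" "card W = 2 ^ (2 * m + 2)"
    and nondeg: "\<And>x. x \<in> W \<Longrightarrow> x \<noteq> 0 \<Longrightarrow> \<exists>y\<in>W. form x y = 1"
    and J: "J \<in> W" "J \<noteq> 0" "form J J = 0" "\<And>x. x \<in> W \<Longrightarrow> form x x = form J x"
    and S: "S \<subseteq> W - {0}" "loopless_triangle_free S"
    and m: "(2 * m + 2) * (2 * m + 5) + 2 \<le> 2 * 2 ^ m"
  shows "card S + 3 \<le> 2 ^ (m + 2)"
proof -
  let ?A = "{x \<in> S. form J x = 0}" and ?C = "{x \<in> S. form J x = 1}"
  have SW: "S \<subseteq> W" using S(1) by blast
  have A_alt: "form x x = 0" if "x \<in> ?A" for x using that SW J(4)[of x] by auto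
  have C_one: "form x x = 1" if "x \<in> ?C" for x using that SW J(4)[of x] by auto
  have xJ: "form x J = form J x" for x by (rule form_sym)
  have fin: "finite S" using S(1) subspaceD(1)[OF W(1)] by (meson finite_Diff finite_subset)
  have Atf: "triangle_free ?A"
  proof (rule loopless_triangle_free_alternating)
    show "loopless_triangle_free ?A" by (rule loopless_triangle_free_subset[OF S(2)]) blast
  qed (rule A_alt)
  let ?V = "\<lambda>b. {x \<in> {x \<in> W. form J x = 0}. form b x = 0}"
  let ?P = "\<lambda>b. {x \<in> ?A. form b x = 0}" and ?Q = "\<lambda>b. {x \<in> ?A. form b x = 1}"
  have V: "symplectic (?V b) m" if b: "b \<in> W" "form J b = 1" for b
    unfolding symplectic_def
  proof (intro conjI ballI impI)
    have bJ: "form b J = 1" using b xJ[of b] by simp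
    have "2 * card {x \<in> W. form J x = 0} = card W" by (rule card_half[OF W(1) b])
    moreover have "2 * card (?V b) = card {x \<in> W. form J x = 0}"
      by (rule card_half[OF subspace_perp[OF W(1)] _ bJ]) (use J(1,3) in simp)
    moreover have "(2::nat) ^ (2 * m + 2) = 4 * 4 ^ m" by (simp add: power_mult)
    ultimately show "card (?V b) = 4 ^ m" using W(2) by linarith
    fix x assume x: "x \<in> ?V b"
    then show "form x x = 0" using J(4)[of x] by simp
    assume orth: "\<forall>y\<in>?V b. form x y = 0"
    have x0: "form x J = 0" "form x b = 0" using x form_sym[of x J] form_sym[of x b] by simp_all
    show "x = 0"
    proof (rule ccontr)
      assume "x \<noteq> 0"
      then obtain y where y: "y \<in> W" "form x y = 1" using nondeg x by blast
      \<comment> \<open>Adding \<open>b\<close> kills the value on \<open>J\<close>; adding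
        \<open>J\<close> afterwards kills the value on \<open>b\<close> and keeps the first, as
        \<open>form J J = 0\<close>. Both leave the pairing with \<open>x\<close> alone.\<close>
      define z where "z = (if form J y = 1 then y + b else y)"
      have z: "z \<in> W" "form J z = 0" "form x z = 1"
        using y b x0 subspaceD(3)[OF W(1)] by (simp_all add: z_def form_add_right)
      define t where "t = (if form b z = 1 then z + J else z)"
      have t: "t \<in> ?V b" "form x t = 1"
        using z bJ J(1,3) x0 subspaceD(3)[OF W(1)] by (simp_all add: t_def form_add_right)
      then show False using orth by force
    qed
  qed (intro subspace_perp W(1))
  have P: "card (?P b) + 2 \<le> 2 * 2 ^ m" if b: "b \<in> W" "form J b = 1" for b
  proof -
    have "card (?P b) + 2 \<le> 2 ^ (m + 1)"
    proof (rule card_triangle_free[OF V[OF b]])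
      show "triangle_free (?P b)" by (rule triangle_free_subset[OF Atf]) blast
    qed (use S(1) in auto)
    then show ?thesis by simp
  qed
  have Q: "(\<lambda>x. x + J) ` ?Q b \<subseteq> ?V b" "card ((\<lambda>x. x + J) ` ?Q b) = card (?Q b)"
    if b: "b \<in> W" "form J b = 1" for b
  proof -
    have "form b J = 1" using b xJ[of b] by simp
    then show "(\<lambda>x. x + J) ` ?Q b \<subseteq> ?V b"
      using SW J(1,3) subspaceD(3)[OF W(1)] by (auto simp: form_add_right)
    show "card ((\<lambda>x. x + J) ` ?Q b) = card (?Q b)" by (rule card_image) (simp add: inj_on_def)
  qed
  \<comment> \<open>\<open>J\<close> lies in the radical of its own perp, so translation by
    \<open>J\<close> preserves the form there.\<close>
  have shift: "form (x + J) (y + J) = form x y" if "x \<in> ?A" "y \<in> ?A" for x y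
    using that J(3) xJ[of x] by (simp add: form_add form_add_right)
  have finA: "finite ?A" using fin by simp
  have split: "card S = card ?A + card ?C" by (rule card_split[OF fin])
  have splitA: "card ?A = card (?P b) + card (?Q b)" for b by (rule card_split[OF finA])
  have pow: "(2::nat) ^ (m + 2) = 4 * 2 ^ m" by simp
  show ?thesis
  proof (cases "?C = {}")
    case True
    obtain b where b: "b \<in> W" "form J b = 1" using nondeg[OF J(1,2)] by blast
    let ?R = "(\<lambda>x. x + J) ` ?Q b"
    \<comment> \<open>The translate contains 0 exactly when \<open>J\<close> is in
      \<open>?Q b\<close>. This one possible extra vector is why the final deficit is 3 and not
      4.\<close>
    have "card (?R - {0}) + 2 \<le> 2 ^ (m + 1)"
    proof (rule card_triangle_free[OF V[OF b]])
      show "?R - {0} \<subseteq> ?V b - {0}" using Q(1)[OF b] by blast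
      have "form x z = 0" if "x \<in> ?R" "y \<in> ?R" "z \<in> ?R" "form x y = 1" "form y z = 1" for x y z
      proof -
        obtain x' y' z' where "x' \<in> ?A" "y' \<in> ?A" "z' \<in> ?A" "x = x' + J" "y = y' + J" "z = z' + J"
          using \<open>x \<in> ?R\<close> \<open>y \<in> ?R\<close> \<open>z \<in> ?R\<close> by blast
        then show ?thesis
          using triangle_freeD[OF Atf, of x' y' z'] that(4,5) shift by simp
      qed
      then show "triangle_free (?R - {0})" unfolding triangle_free_def by blast
    qed
    moreover have "card ?R - 1 \<le> card (?R - {0})" using diff_card_le_card_Diff[of "{0}" ?R] by simp
    moreover have "(2::nat) ^ (m + 1) = 2 * 2 ^ m" by simp
    moreover have "card ?C = 0" using True by (metis card.empty)
    ultimately show ?thesis using P[OF b] Q(2)[OF b] split splitA[of b] pow by linarith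
  next
    case False
    then obtain b where bC: "b \<in> ?C" by blast
    then have b: "b \<in> W" "form J b = 1" using SW by auto
    have R: "card ((\<lambda>x. x + J) ` ?Q b) \<le> 2 ^ m"
    proof (rule card_isotropic[OF V[OF b] Q(1)[OF b]])
      \<comment> \<open>\<open>?Q b\<close> consists of neighbours of \<open>b\<close>, a member of
        \<open>S\<close>, so adjacent vectors in it would close a triangle.\<close>
      have iso: "form x y = 0" if "x \<in> ?Q b" "y \<in> ?Q b" for x y
      proof (cases "x = y")
        case True
        then show ?thesis using that A_alt by auto
      next
        case False
        have "b \<noteq> x" "b \<noteq> y" using that b by auto
        then show ?thesis using loopless_triangle_freeD[OF S(2), of b x y] that bC False by simp
      qed
      have "form (x + J) (y + J) = 0" if "x \<in> ?Q b" "y \<in> ?Q b" for x y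
        using that shift[of x y] iso[OF that] by simp
      then show "isotropic ((\<lambda>x. x + J) ` ?Q b)" unfolding isotropic_def by blast
    qed
    have "2 * card ?C \<le> (2 * m + 2) * ((2 * m + 2) + 3)"
    proof (rule card_nonisotropic_triangle_free[OF W(1)])
      show "loopless_triangle_free ?C" by (rule loopless_triangle_free_subset[OF S(2)]) blast
    qed (use W(2) SW C_one in auto)
    moreover have eq: "2 * m + 2 + 3 = 2 * m + 5" by simp
    ultimately have C: "2 * card ?C + 2 \<le> 2 * 2 ^ m" using m unfolding eq by linarith
    have "a + c + 3 \<le> 4 * q"
      if "r = d" "r \<le> q" "2 * c + 2 \<le> 2 * q" "p + 2 \<le> 2 * q" "a = p + d"
      for a c d p q r :: nat using that by linarith
    from this[OF Q(2)[OF b] R C P[OF b] splitA] show ?thesis unfolding split pow .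
  qed
qed

end

section \<open>Coordinates\<close>

text \<open>Vectors of length \<open>n\<close> are moved to functions supported on \<open>{..<n}\<close>, because \<^typ>\<open>bit vec\<close>, with
  its partial addition, is not a group.\<close>

definition coords :: "nat \<Rightarrow> (nat \<Rightarrow> bit) set" where
  "coords n = {f. \<forall>i\<ge>n. f i = 0}"

definition coord :: "bit vec \<Rightarrow> nat \<Rightarrow> bit" where
  "coord x = (\<lambda>i. if i < dim_vec x then x $ i else 0)"

lemma vec_coord: "x \<in> carrier_vec n \<Longrightarrow> vec n (coord x) = x"
  by (auto simp: coord_def)

lemma coord_in_coords: "x \<in> carrier_vec n \<Longrightarrow> coord x \<in> coords n"
  by (auto simp: coord_def coords_def)

lemma inj_on_coord: "inj_on coord (carrier_vec n)"
  by (rule inj_on_inverseI[where g = "vec n"]) (rule vec_coord)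

lemma vec_add_fun: "vec n (f + g) = vec n f + vec n (g :: nat \<Rightarrow> bit)"
  by auto

lemma coords_Suc: "coords (Suc n) = coords n \<union> (\<lambda>f. f(n := 1)) ` coords n"
proof -
  have "f \<in> coords n \<union> (\<lambda>f. f(n := 1)) ` coords n" if "f \<in> coords (Suc n)" for f
  proof (cases "f n = 0")
    case True
    moreover have "f i = 0" if "n < i" for i
      using \<open>f \<in> coords (Suc n)\<close> that by (simp add: coords_def)
    ultimately have "f \<in> coords n" by (auto simp: coords_def order_le_less)
    then show ?thesis by simp
  next
    case False
    have "f(n := 0) \<in> coords n" using that by (simp add: coords_def)
    moreover have "f = (f(n := 0))(n := 1)" using False by (auto simp: fun_eq_iff)
    ultimately show ?thesis by blast
  qed
  then show ?thesis by (auto simp: coords_def)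
qed

lemma card_coords: "finite (coords n) \<and> card (coords n) = 2 ^ n"
proof (induction n)
  case 0
  have "coords 0 = {\<lambda>_. 0}" by (auto simp: coords_def)
  then show ?case by simp
next
  case (Suc n)
  have zero: "f n = 0" if "f \<in> coords n" for f using that by (simp add: coords_def)
  then have "coords n \<inter> (\<lambda>f. f(n := 1)) ` coords n = {}" by force
  moreover have "f = (f(n := 1))(n := 0)" if "f \<in> coords n" for f
    using zero[OF that] by (auto simp: fun_eq_iff)
  then have "inj_on (\<lambda>f. f(n := 1)) (coords n)" by (intro inj_on_inverseI[where g = "\<lambda>f. f(n := 0)"]) simp
  ultimately show ?case
    using Suc by (simp add: coords_Suc card_Un_disjoint card_image)
qed

locale vec_form =
  fixes n :: nat and B :: "bit vec \<Rightarrow> bit vec \<Rightarrow> bit"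
  assumes B_add: "\<And>x y z. x \<in> carrier_vec n \<Longrightarrow> y \<in> carrier_vec n \<Longrightarrow> z \<in> carrier_vec n \<Longrightarrow>
      B (x + y) z = B x z + B y z"
    and B_sym: "\<And>x y. x \<in> carrier_vec n \<Longrightarrow> y \<in> carrier_vec n \<Longrightarrow> B x y = B y x"
begin

text \<open>Truncating by \<open>vec n\<close> makes the laws hold for all functions, so no carrier
  conditions remain.\<close>

sublocale char_2_form "\<lambda>f g. B (vec n f) (vec n g)"
proof
  show "f + f = 0" for f :: "nat \<Rightarrow> bit" by (auto simp: fun_eq_iff)
  show "B (vec n (f + g)) (vec n h) = B (vec n f) (vec n h) + B (vec n g) (vec n h)" for f g h
    unfolding vec_add_fun by (rule B_add) auto
  show "B (vec n f) (vec n g) = B (vec n g) (vec n f)" for f g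
    by (rule B_sym) auto
qed

lemma subspace_coords: "subspace (coords n)"
  using card_coords[of n] by (auto simp: subspace_def coords_def)

lemma three_two_orthogonal_coord:
  assumes S: "three_two_orthogonal n B S"
  shows "coord ` S \<subseteq> coords n - {0}" "loopless_triangle_free (coord ` S)" "card (coord ` S) = card S"
proof -
  have SV: "S \<subseteq> carrier_vec n - {0\<^sub>v n}" using S by (simp add: three_two_orthogonal_def)
  have eq: "vec n (coord x) = x" if "x \<in> S" for x using SV that by (intro vec_coord) blast
  show "coord ` S \<subseteq> coords n - {0}"
  proof
    fix f assume "f \<in> coord ` S"
    then obtain x where x: "x \<in> S" "f = coord x" by blast
    have "f \<noteq> 0"
    proof
      assume "f = 0"
      then have "x = 0\<^sub>v n" using eq[OF x(1)] x(2) by auto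
      then show False using SV x(1) by blast
    qed
    then show "f \<in> coords n - {0}" using SV x coord_in_coords by blast
  qed
  show "loopless_triangle_free (coord ` S)"
    unfolding loopless_triangle_free_def
  proof (intro ballI impI)
    fix f g h assume fgh: "f \<in> coord ` S" "g \<in> coord ` S" "h \<in> coord ` S"
      and ne: "f \<noteq> g" "f \<noteq> h" "g \<noteq> h"
      and one: "B (vec n f) (vec n g) = 1" "B (vec n f) (vec n h) = 1"
    obtain x y z where xyz: "x \<in> S" "y \<in> S" "z \<in> S" "f = coord x" "g = coord y" "h = coord z"
      using fgh by blast
    then have ne': "x \<noteq> y" "x \<noteq> z" "y \<noteq> z" using ne by auto
    have one': "B x y = 1" "B x z = 1" using one xyz eq by simp_all
    then have "B y x = 1" "B z x = 1" using B_sym xyz(1,2,3) SV by (metis DiffD1 subsetD)+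
    moreover have "\<exists>u\<in>{x, y, z}. \<exists>v\<in>{x, y, z}. u \<noteq> v \<and> mutually_orthogonal n B u v"
      using S xyz(1-3) ne' unfolding three_two_orthogonal_def by blast
    then have "\<exists>u\<in>{x, y, z}. \<exists>v\<in>{x, y, z}. u \<noteq> v \<and> B u v = 0"
      unfolding mutually_orthogonal_def by blast
    ultimately have "B y z = 0 \<or> B z y = 0" using one' by auto
    then have "B y z = 0" using B_sym xyz(1,2,3) SV by (metis DiffD1 subsetD)
    then show "B (vec n g) (vec n h) = 0" using xyz eq by simp
  qed
  show "card (coord ` S) = card S"
    using SV by (intro card_image inj_on_subset[OF inj_on_coord]) blast
qed

end

section \<open>The dot product and the all-ones vector\<close>

interpretation dot: vec_form n "\<lambda>x y. x \<bullet> y" for n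
  by unfold_locales (rule add_scalar_prod_distrib comm_scalar_prod; assumption)+

lemma dot_vec: "vec n f \<bullet> vec n g = (\<Sum>i<n. f i * (g i :: bit))"
  by (simp add: scalar_prod_def atLeast0LessThan)

definition ones :: "nat \<Rightarrow> nat \<Rightarrow> bit" where
  "ones n i = of_bool (i < n)"

lemma dot_nondegenerate:
  assumes "f \<in> coords n" "f \<noteq> 0"
  shows "\<exists>g\<in>coords n. vec n f \<bullet> vec n g = 1"
proof -
  obtain i where i: "f i \<noteq> 0" using assms(2) by (auto simp: fun_eq_iff)
  then have "i < n" using assms(1) by (cases "i < n") (auto simp: coords_def)
  let ?g = "\<lambda>j. of_bool (j = i) :: bit"
  have "vec n f \<bullet> vec n ?g = (\<Sum>j<n. if j = i then f j else 0)"
    unfolding dot_vec by (intro sum.cong) auto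
  also have "\<dots> = 1" using \<open>i < n\<close> i by simp
  finally show ?thesis using \<open>i < n\<close> by (intro bexI[of _ ?g]) (auto simp: coords_def)
qed

text \<open>Squaring is the identity on two elements, hence \<open>x . x = J . x\<close>. The parity
  of \<open>n\<close> decides whether \<open>J\<close> lies in its own perp, which separates the two
  cases of the theorem.\<close>

lemma ones_props:
  "ones n \<in> coords n" "vec n (ones n) \<bullet> vec n (ones n) = of_bool (odd n)"
  "vec n f \<bullet> vec n f = vec n (ones n) \<bullet> vec n f"
proof -
  show "ones n \<in> coords n" by (auto simp: coords_def ones_def)
  show "vec n (ones n) \<bullet> vec n (ones n) = of_bool (odd n)"
  proof -
    have "of_nat k = (of_bool (odd k) :: bit)" for k by (induction k) auto
    moreover have "vec n (ones n) \<bullet> vec n (ones n) = of_nat n"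
      unfolding dot_vec by (simp add: ones_def)
    ultimately show ?thesis by simp
  qed
  show "vec n f \<bullet> vec n f = vec n (ones n) \<bullet> vec n f"
    unfolding dot_vec by (rule sum.cong) (auto simp: ones_def)
qed

section \<open>The hyperbolic form in coordinates\<close>

definition partner :: "nat \<Rightarrow> nat" where
  "partner i = (if even i then i + 1 else i - 1)"

lemma partner_less: "i < 2 * m \<Longrightarrow> partner i < 2 * m"
  by (auto simp: partner_def elim!: evenE)

lemma partner_ge: "2 \<le> i \<Longrightarrow> 2 \<le> partner i"
  unfolding partner_def by presburger

lemma hyperbolic_mat_carrier: "hyperbolic_mat (2 * m) \<in> carrier_mat (2 * m) (2 * m)"
proof -
  have "dim_row (diag_block_mat (replicate m hyperbolic_block)) = 2 * m \<and>
        dim_col (diag_block_mat (replicate m hyperbolic_block)) = 2 * m"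
    by (induction m) (simp_all add: Let_def hyperbolic_block_def mat_of_rows_list_def)
  then show ?thesis by (intro carrier_matI) (simp_all add: hyperbolic_mat_def)
qed

text \<open>The matrix is the permutation matrix of the involution \<open>partner\<close>. Induction
  peels off the first block, and \<open>partner\<close> commutes with the shift by 2.\<close>

lemma hyperbolic_mat_index:
  "i < 2 * m \<Longrightarrow> j < 2 * m \<Longrightarrow> hyperbolic_mat (2 * m) $$ (i, j) = of_bool (j = partner i)"
proof (induction m arbitrary: i j)
  case (Suc m)
  have H: "hyperbolic_block \<in> carrier_mat 2 2"
    by (rule carrier_matI) (simp_all add: hyperbolic_block_def mat_of_rows_list_def)
  have Hij: "hyperbolic_block $$ (i, j) = of_bool (j = partner i)" if "i < 2" "j < 2" for i j
  proof -
    have "i = 0 \<or> i = 1" "j = 0 \<or> j = 1" using that by auto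
    then show ?thesis by (auto simp: hyperbolic_block_def mat_of_rows_list_def partner_def)
  qed
  have "hyperbolic_mat (2 * Suc m) =
    four_block_mat hyperbolic_block (0\<^sub>m 2 (2 * m)) (0\<^sub>m (2 * m) 2) (hyperbolic_mat (2 * m))"
    using hyperbolic_mat_carrier[of m] H by (simp add: hyperbolic_mat_def Let_def)
  then have "hyperbolic_mat (2 * Suc m) $$ (i, j) =
     (if i < 2 then if j < 2 then hyperbolic_block $$ (i, j) else 0
      else if j < 2 then 0 else hyperbolic_mat (2 * m) $$ (i - 2, j - 2))"
    using hyperbolic_mat_carrier[of m] H Suc.prems by auto
  also have "\<dots> = of_bool (j = partner i)"
  proof -
    consider "i < 2" "j < 2" | "i < 2" "2 \<le> j" | "2 \<le> i" "j < 2" | "2 \<le> i" "2 \<le> j" by linarith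
    then show ?thesis
    proof cases
      case 4
      then have "hyperbolic_mat (2 * m) $$ (i - 2, j - 2) = of_bool (j - 2 = partner (i - 2))"
        using Suc.prems by (intro Suc.IH) auto
      moreover have "j - 2 = partner (i - 2) \<longleftrightarrow> j = partner i"
        using 4 by (auto simp: partner_def elim!: evenE oddE)
      ultimately show ?thesis using 4 by simp
    qed (use Hij[of i j] partner_less[of i 1] partner_ge in fastforce)+
  qed
  finally show ?case .
qed simp

lemma partner_partner: "partner (partner i) = i"
  by (auto simp: partner_def)

lemma hyperbolic_form_partner:
  "hyperbolic_form (2 * m) (vec (2 * m) f) (vec (2 * m) g) = (\<Sum>i<2 * m. f i * g (partner i))"
proof -
  let ?M = "hyperbolic_mat (2 * m)"
  have M: "?M \<in> carrier_mat (2 * m) (2 * m)" by (rule hyperbolic_mat_carrier)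
  have "(?M *\<^sub>v vec (2 * m) g) $ i = g (partner i)" if i: "i < 2 * m" for i
  proof -
    have "(?M *\<^sub>v vec (2 * m) g) $ i = (\<Sum>j<2 * m. ?M $$ (i, j) * g j)"
      using M i by (simp add: scalar_prod_def atLeast0LessThan)
    also have "\<dots> = (\<Sum>j<2 * m. if j = partner i then g j else 0)"
      by (intro sum.cong) (use hyperbolic_mat_index[OF i] in auto)
    also have "\<dots> = g (partner i)" using partner_less[OF i] by simp
    finally show ?thesis .
  qed
  then show ?thesis
    using M by (simp add: hyperbolic_form_def scalar_prod_def atLeast0LessThan)
qed

lemma sum_lessThan_double:
  fixes h :: "nat \<Rightarrow> 'a::comm_monoid_add"
  shows "(\<Sum>i<2 * m. h i) = (\<Sum>i<m. h (2 * i) + h (2 * i + 1))"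
  by (induction m) (simp_all add: add.assoc)

text \<open>Grouped by blocks, symmetry holds term by term, and so does vanishing on the diagonal,
  where each term is \<open>a * b + b * a\<close>.\<close>

lemma hyperbolic_form_pairs:
  "hyperbolic_form (2 * m) (vec (2 * m) f) (vec (2 * m) g) =
     (\<Sum>i<m. f (2 * i) * g (2 * i + 1) + f (2 * i + 1) * g (2 * i))"
  unfolding hyperbolic_form_partner sum_lessThan_double
  by (rule sum.cong) (simp_all add: partner_def)

lemma hyperbolic_vec_form: "vec_form (2 * m) (hyperbolic_form (2 * m))"
proof
  let ?n = "2 * m" and ?B = "hyperbolic_form (2 * m)"
  show "?B x y = ?B y x" if "x \<in> carrier_vec ?n" "y \<in> carrier_vec ?n" for x y
  proof -
    have "?B (vec ?n f) (vec ?n g) = ?B (vec ?n g) (vec ?n f)" for f g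
      unfolding hyperbolic_form_pairs by (intro sum.cong refl) (metis add.commute mult.commute)
    from this[of "coord x" "coord y"] show ?thesis using vec_coord that by simp
  qed
  show "?B (x + y) z = ?B x z + ?B y z"
    if "x \<in> carrier_vec ?n" "y \<in> carrier_vec ?n" "z \<in> carrier_vec ?n" for x y z
  proof -
    have "?B (vec ?n (f + g)) (vec ?n h) = ?B (vec ?n f) (vec ?n h) + ?B (vec ?n g) (vec ?n h)" for f g h
      unfolding hyperbolic_form_partner sum.distrib[symmetric]
      by (rule sum.cong) (simp_all only: plus_fun_apply distrib_right)
    from this[of "coord x" "coord y" "coord z"] show ?thesis
      unfolding vec_add_fun using vec_coord that by simp
  qed
qed

lemma hyperbolic_nondegenerate:
  assumes "f \<in> coords (2 * m)" "f \<noteq> 0"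
  shows "\<exists>g\<in>coords (2 * m). hyperbolic_form (2 * m) (vec (2 * m) f) (vec (2 * m) g) = 1"
proof -
  obtain i where i: "f i \<noteq> 0" using assms(2) by (auto simp: fun_eq_iff)
  then have im: "i < 2 * m" using assms(1) by (cases "i < 2 * m") (auto simp: coords_def)
  \<comment> \<open>The unit vector at \<open>partner i\<close>, which picks out the coordinate
    \<open>f i\<close>.\<close>
  let ?g = "\<lambda>j. of_bool (partner j = i) :: bit"
  have "hyperbolic_form (2 * m) (vec (2 * m) f) (vec (2 * m) ?g) =
      (\<Sum>j<2 * m. if j = i then f j else 0)"
    unfolding hyperbolic_form_partner partner_partner by (intro sum.cong) auto
  also have "\<dots> = 1" using im i by simp
  finally have "hyperbolic_form (2 * m) (vec (2 * m) f) (vec (2 * m) ?g) = 1" .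
  moreover have "?g \<in> coords (2 * m)"
    using partner_less[OF im] partner_partner by (auto simp: coords_def)
  ultimately show ?thesis by blast
qed

lemma hyperbolic_symplectic:
  "char_2_form.symplectic (\<lambda>f g. hyperbolic_form (2 * m) (vec (2 * m) f) (vec (2 * m) g))
     (coords (2 * m)) m"
proof -
  interpret vec_form "2 * m" "hyperbolic_form (2 * m)" by (rule hyperbolic_vec_form)
  have comm: "a * b + b * a = 0" for a b :: bit by (cases a; cases b) simp_all
  show ?thesis
    unfolding symplectic_def
  proof (intro conjI ballI impI)
    show "card (coords (2 * m)) = 4 ^ m" using card_coords[of "2 * m"] by (simp add: power_mult)
    fix f assume f: "f \<in> coords (2 * m)"
    show "hyperbolic_form (2 * m) (vec (2 * m) f) (vec (2 * m) f) = 0"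
      unfolding hyperbolic_form_pairs by (intro sum.neutral ballI) (rule comm)
    assume "\<forall>g\<in>coords (2 * m). hyperbolic_form (2 * m) (vec (2 * m) f) (vec (2 * m) g) = 0"
    then show "f = 0" using hyperbolic_nondegenerate[OF f] by force
  qed (rule subspace_coords)
qed

text \<open>The source of the thresholds: \<open>k\<close> is \<open>(n - 5) div 2\<close> for odd
  \<open>n\<close> and \<open>(n - 2) div 2\<close> for even \<open>n\<close>, so
  \<open>8 <= k\<close> means \<open>n >= 21\<close> and \<open>n >= 18\<close>. Both inequalities
  fail at 7.\<close>

lemma quadratic_le_power:
  assumes "(8::nat) \<le> k"
  shows "(2 * k + 5) * (2 * k + 8) \<le> 2 * (2 ^ k + 3)"
    and "(2 * k + 2) * (2 * k + 5) + 2 \<le> 2 * 2 ^ k"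
proof -
  show 1: "(2 * k + 5) * (2 * k + 8) \<le> 2 * (2 ^ k + 3)"
    using assms
  proof (induction k rule: dec_induct)
    case (step k)
    then have "k * 8 \<le> k * k" by (intro mult_left_mono) auto
    then show ?case using step by (simp add: algebra_simps)
  qed simp
  show "(2 * k + 2) * (2 * k + 5) + 2 \<le> 2 * 2 ^ k"
    using 1 by (simp add: algebra_simps)
qed

theorem theorem2p2:
  fixes n :: nat
  shows "(\<forall>S. three_two_orthogonal n (\<lambda>x y. x \<bullet> y) S \<longrightarrow>
            (n \<ge> 21 \<and> odd n \<longrightarrow> card S \<le> 2 ^ ((n + 1) div 2) + 1) \<and>
            (n \<ge> 18 \<and> even n \<longrightarrow> card S \<le> 2 ^ (n div 2 + 1) - 3)) \<and>
         (n \<ge> 2 \<and> even n \<longrightarrow>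
            (\<forall>S. three_two_orthogonal n (hyperbolic_form n) S \<longrightarrow>
                 card S \<le> 2 ^ (n div 2 + 1) - 2))"
proof (intro conjI allI impI; (elim conjE)?)
  fix S assume S: "three_two_orthogonal n (\<lambda>x y. x \<bullet> y) S"
  note S' = dot.three_two_orthogonal_coord[OF S]
  {
    assume n: "n \<ge> 21" "odd n"
    \<comment> \<open>Chosen so that the perp of the all-ones vector has dimension
      \<open>n - 1 = 2 * (k + 2)\<close>.\<close>
    define k where "k = (n - 5) div 2"
    have k: "n = 2 * k + 5" "k \<ge> 8" using n by (auto simp: k_def elim!: oddE)
    have "card (coord ` S) \<le> 2 ^ (k + 3) + 1"
    proof (rule dot.card_odd_dimension[OF dot.subspace_coords _ dot_nondegenerate ones_props(1) _ ones_props(3) S'(1,2)])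
      show "card (coords n) = 2 ^ (2 * k + 5)" using card_coords k by simp
      show "vec n (ones n) \<bullet> vec n (ones n) = 1" unfolding ones_props(2) using n by simp
    qed (use quadratic_le_power(1) k in auto)
    moreover have "(n + 1) div 2 = k + 3" using k by simp
    ultimately show "card S \<le> 2 ^ ((n + 1) div 2) + 1" using S'(3) by simp
  next
    assume n: "n \<ge> 18" "even n"
    define m where "m = (n - 2) div 2"
    have m: "n = 2 * m + 2" "m \<ge> 8" using n by (auto simp: m_def elim!: evenE)
    have "card (coord ` S) + 3 \<le> 2 ^ (m + 2)"
    proof (rule dot.card_even_dimension[OF dot.subspace_coords _ dot_nondegenerate ones_props(1) _ _ ones_props(3) S'(1,2)])
      show "card (coords n) = 2 ^ (2 * m + 2)" using card_coords m by simp
      show "vec n (ones n) \<bullet> vec n (ones n) = 0" unfolding ones_props(2) using n by simp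
      have "ones n 0 \<noteq> 0" using n by (simp add: ones_def)
      then show "ones n \<noteq> 0" by auto
    qed (use quadratic_le_power(2) m in auto)
    moreover have "n div 2 + 1 = m + 2" using m by simp
    \<comment> \<open>The additive bound \<open>card + 3 <= 2 ^ (m + 2)\<close> keeps the
      natural-number subtraction from truncating.\<close>
    ultimately show "card S \<le> 2 ^ (n div 2 + 1) - 3" using S'(3) by simp
  }
next
  fix S assume "even n" and S: "three_two_orthogonal n (hyperbolic_form n) S"
  then obtain m where m: "n = 2 * m" by (elim evenE)
  interpret vec_form "2 * m" "hyperbolic_form (2 * m)" by (rule hyperbolic_vec_form)
  note S' = three_two_orthogonal_coord[OF S[unfolded m]]
  have "triangle_free (coord ` S)"
  proof (rule loopless_triangle_free_alternating[OF S'(2)])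
    show "hyperbolic_form (2 * m) (vec (2 * m) x) (vec (2 * m) x) = 0" if "x \<in> coord ` S" for x
      using symplecticD(3)[OF hyperbolic_symplectic, of x] S'(1) that by blast
  qed
  from card_triangle_free[OF hyperbolic_symplectic S'(1) this]
  show "card S \<le> 2 ^ (n div 2 + 1) - 2" using S'(3) m by simp
qed

end
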